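(* Let $K$ be a positive integer (the number of colors), and consider the $V_2$ dynamics of a spin complex representing one of $K$ colors, that is, the dynamics of relaxed spins $(\sigma_\alpha, X_\alpha)$, $\alpha = 1,\dots,K$, in the presence of the fixed auxiliary spin $(\sigma_0,X_0)=(1,0)$, given by $$\dot X_\alpha = \frac12 \sum_{\beta=0}^{K} q_\beta\, \sigma_\alpha\sigma_\beta\, \operatorname{sgn}(X_\alpha - X_\beta),\qquad \alpha=1,\dots,K,$$ with $q_0 = K-2$ and $q_\beta = 1$ for $1\le\beta\le K$. Then the only stable equilibrium states $(\boldsymbol\sigma,\mathbf X)$ of this dynamics are states with definite color; that is, if $(\boldsymbol\sigma,\mathbf X)$ is a stable equilibrium state, then exactly one index $\alpha\in\{1,\dots,K\}$ has $\sigma_\alpha = +1$ and all the other indices in $\{1,\dots,K\}$ have $\sigma_\alpha=-1$.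
   Context: Relaxed spins: a relaxed spin is a pair $(\sigma, X)$ with $\sigma\in\{-1,+1\}$ and $X\in[-1,1)$. It represents the point $\xi = \sigma + X$ of the circle $\mathbb R/4\mathbb Z$; every point of the circle has exactly one such representation. The topology of the state space is that of the circle: $(\sigma, X)$ with $X\to 1^-$ tends to $(-\sigma,-1)$, and whenever $X$ crosses the boundary $\pm1$ during the evolution, it reappears at the opposite end of the interval and $\sigma$ changes sign. Color encoding: a color is one-hot encoded by $K$ spins. A state $(\boldsymbol\sigma,\mathbf X)$ of the spin complex is a state with definite color if exactly one of $\sigma_1,\dots,\sigma_K$ equals $+1$. The auxiliary spin has index $0$ and is kept fixed: $\sigma_0 = 1$, $X_0=0$. The interaction graph is the complete graph on the nodes $\{0,1,\dots,K\}$ with symmetric weights $A_{\alpha\beta}=1$ for distinct $\alpha,\beta\ge1$, $A_{0\alpha}=A_{\alpha0}=K-2$ for $\alpha\ge 1$, and $A_{\alpha\alpha}=0$. The relaxed cut function of the $V_2$ model is $$C_V(\boldsymbol\sigma,\mathbf X) = \frac14\sum_{\alpha,\beta=0}^{K} A_{\alpha\beta}(1-\sigma_\alpha\sigma_\beta) + \frac14\sum_{\alpha,\beta=0}^{K} A_{\alpha\beta}\,\sigma_\alpha\sigma_\beta\,|X_\alpha - X_\beta| ,$$ which is a continuous function on $(\mathbb R/4\mathbb Z)^K$ under the identification above. The dynamics in the claim is the gradient ascent $\dot X_\alpha = \partial C_V/\partial X_\alpha$, $\alpha=1,\dots,K$, with the convention $\operatorname{sgn}(0)=0$. An equilibrium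 state is a state at which the right-hand side of the equation of motion vanishes for every $\alpha=1,\dots,K$. An equilibrium is stable if it is a local maximum (not necessarily strict) of $C_V$ on $(\mathbb R/4\mathbb Z)^K$, so that no arbitrarily small perturbation increases $C_V$; other equilibria are saddle-type critical points. *)

theory Defs
  imports "HOL-Analysis.Analysis"
begin

text \<open>
  A relaxed spin is a pair \<open>(\<sigma>, X)\<close> with \<open>\<sigma> = \<plusminus>1\<close> and \<open>-1 \<le> X < 1\<close>; it stands for the
  point \<open>\<sigma> + X\<close> of the circle \<open>\<real>/4\<int>\<close>.
\<close>

type_synonym spin = "real \<times> real"

definition relaxed_spins :: "spin set" where
  "relaxed_spins = {-1, 1} \<times> {-1..<1}"

definition represents :: "spin \<Rightarrow> real \<Rightarrow> bool" where
  "represents p \<xi> \<longleftrightarrow> (\<exists>n::int. \<xi> = fst p + snd p + 4 * of_int n)"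

lemma represents_unique:
  assumes "p \<in> relaxed_spins" "q \<in> relaxed_spins" "represents p \<xi>" "represents q \<xi>"
  shows "p = q"
proof -
  obtain m n :: int where m: "\<xi> = fst p + snd p + 4 * of_int m" and n: "\<xi> = fst q + snd q + 4 * of_int n"
    using assms(3,4) unfolding represents_def by blast
  have b: "-2 \<le> fst p + snd p" "fst p + snd p < 2" "-2 \<le> fst q + snd q" "fst q + snd q < 2"
    using assms(1,2) by (auto simp: relaxed_spins_def)
  have "real_of_int (m - n) < 1" "real_of_int (n - m) < 1"
    using m n b by simp_all
  then have "m - n < 1" "n - m < 1" by linarith+
  then have "m = n" by simp
  then have "fst p + snd p = fst q + snd q" using m n by simp
  then show ?thesis using assms(1,2) by (auto simp: relaxed_spins_def prod_eq_iff)
qed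

lemma represents_exists: "\<exists>p \<in> relaxed_spins. represents p \<xi>"
proof -
  define n where "n = \<lfloor>(\<xi> + 2) / 4\<rfloor>"
  define y where "y = \<xi> - 4 * of_int n"
  have "of_int n \<le> (\<xi> + 2) / 4" "(\<xi> + 2) / 4 < of_int n + 1"
    unfolding n_def by linarith+
  then have y: "-2 \<le> y" "y < 2" by (simp_all add: y_def)
  define p :: spin where "p = (if y < 0 then (-1, y + 1) else (1, y - 1))"
  have "p \<in> relaxed_spins" using y by (auto simp: p_def relaxed_spins_def)
  moreover have "represents p \<xi>"
    unfolding represents_def by (rule exI[of _ n]) (simp add: p_def y_def)
  ultimately show ?thesis by blast
qed

text \<open>
  The quotient topology of \<open>\<real>/4\<int>\<close>, carried over to relaxed spins: a set of spins is open iff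
  its preimage under the projection from the real line is open.
\<close>

definition circle_topology :: "spin topology" where
  "circle_topology =
     topology (\<lambda>U. U \<subseteq> relaxed_spins \<and> open {\<xi>. \<exists>p\<in>U. represents p \<xi>})"

lemma openin_circle_topology:
  "openin circle_topology U \<longleftrightarrow> U \<subseteq> relaxed_spins \<and> open {\<xi>. \<exists>p\<in>U. represents p \<xi>}"
proof -
  have "istopology (\<lambda>U. U \<subseteq> relaxed_spins \<and> open {\<xi>. \<exists>p\<in>U. represents p \<xi>})"
    unfolding istopology_def
  proof (intro conjI allI impI)
    fix S T :: "spin set"
    assume S: "S \<subseteq> relaxed_spins \<and> open {\<xi>. \<exists>p\<in>S. represents p \<xi>}"
       and T: "T \<subseteq> relaxed_spins \<and> open {\<xi>. \<exists>p\<in>T. represents p \<xi>}"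
    show "S \<inter> T \<subseteq> relaxed_spins" using S by blast
    have "{\<xi>. \<exists>p\<in>S \<inter> T. represents p \<xi>} =
          {\<xi>. \<exists>p\<in>S. represents p \<xi>} \<inter> {\<xi>. \<exists>p\<in>T. represents p \<xi>}" (is "?L = ?R")
    proof
      show "?L \<subseteq> ?R" by blast
      show "?R \<subseteq> ?L"
      proof
        fix \<xi> assume "\<xi> \<in> ?R"
        then obtain p q where "p \<in> S" "q \<in> T" "represents p \<xi>" "represents q \<xi>" by blast
        moreover from this have "p = q" using S T represents_unique by blast
        ultimately show "\<xi> \<in> ?L" by blast
      qed
    qed
    then show "open {\<xi>. \<exists>p\<in>S \<inter> T. represents p \<xi>}" using S T by (simp add: open_Int)
  next
    fix \<K> :: "spin set set"
    assume K: "\<forall>U\<in>\<K>. U \<subseteq> relaxed_spins \<and> open {\<xi>. \<exists>p\<in>U. represents p \<xi>}"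
    then show "\<Union>\<K> \<subseteq> relaxed_spins" by blast
    have "{\<xi>. \<exists>p\<in>\<Union>\<K>. represents p \<xi>} = (\<Union>U\<in>\<K>. {\<xi>. \<exists>p\<in>U. represents p \<xi>})" by blast
    then show "open {\<xi>. \<exists>p\<in>\<Union>\<K>. represents p \<xi>}" using K by (simp add: open_UN)
  qed
  then show ?thesis by (simp add: circle_topology_def)
qed

lemma topspace_circle_topology: "topspace circle_topology = relaxed_spins"
proof -
  have "{\<xi>. \<exists>p\<in>relaxed_spins. represents p \<xi>} = UNIV" using represents_exists by blast
  then have "openin circle_topology relaxed_spins" by (simp add: openin_circle_topology)
  then show ?thesis
    by (metis openin_circle_topology openin_subset openin_topspace subset_antisym)
qed

text \<open>
  A state of the spin complex assigns a relaxed spin to each of the nodes \<open>1, \<dots>, K\<close>. The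
  auxiliary node \<open>0\<close> is not a degree of freedom; it is added by \<open>sgm\<close> and \<open>pos\<close> below.
\<close>

type_synonym state = "nat \<Rightarrow> spin"

definition state_topology :: "nat \<Rightarrow> state topology" where
  "state_topology K = product_topology (\<lambda>_. circle_topology) {1..K}"

lemma topspace_state_topology:
  "topspace (state_topology K) = (\<Pi>\<^sub>E \<alpha>\<in>{1..K}. relaxed_spins)"
  by (simp add: state_topology_def topspace_circle_topology)

definition sgm :: "state \<Rightarrow> nat \<Rightarrow> real" where
  "sgm s \<alpha> = (if \<alpha> = 0 then 1 else fst (s \<alpha>))"

definition pos :: "state \<Rightarrow> nat \<Rightarrow> real" where
  "pos s \<alpha> = (if \<alpha> = 0 then 0 else snd (s \<alpha>))"

definition weight :: "nat \<Rightarrow> nat \<Rightarrow> nat \<Rightarrow> real" where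
  "weight K \<alpha> \<beta> = (if \<alpha> = \<beta> then 0 else if \<alpha> = 0 \<or> \<beta> = 0 then real K - 2 else 1)"

definition cut_V :: "nat \<Rightarrow> state \<Rightarrow> real" where
  "cut_V K s =
     (1/4) * (\<Sum>\<alpha>=0..K. \<Sum>\<beta>=0..K. weight K \<alpha> \<beta> * (1 - sgm s \<alpha> * sgm s \<beta>))
   + (1/4) * (\<Sum>\<alpha>=0..K. \<Sum>\<beta>=0..K. weight K \<alpha> \<beta> * sgm s \<alpha> * sgm s \<beta> * \<bar>pos s \<alpha> - pos s \<beta>\<bar>)"

definition charge :: "nat \<Rightarrow> nat \<Rightarrow> real" where
  "charge K \<beta> = (if \<beta> = 0 then real K - 2 else 1)"

lemma weight_eq_charge:
  "\<alpha> \<ge> 1 \<Longrightarrow> \<beta> \<noteq> \<alpha> \<Longrightarrow> weight K \<alpha> \<beta> = charge K \<beta>"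
  by (simp add: weight_def charge_def)

text \<open>The right-hand side of the equation of motion of node \<open>\<alpha>\<close>; note that \<open>sgn 0 = 0\<close>.\<close>

definition velocity :: "nat \<Rightarrow> state \<Rightarrow> nat \<Rightarrow> real" where
  "velocity K s \<alpha> =
     (1/2) * (\<Sum>\<beta>=0..K. charge K \<beta> * sgm s \<alpha> * sgm s \<beta> * sgn (pos s \<alpha> - pos s \<beta>))"

definition equilibrium :: "nat \<Rightarrow> state \<Rightarrow> bool" where
  "equilibrium K s \<longleftrightarrow>
     s \<in> topspace (state_topology K) \<and> (\<forall>\<alpha>\<in>{1..K}. velocity K s \<alpha> = 0)"

definition local_max_on :: "'a topology \<Rightarrow> ('a \<Rightarrow> real) \<Rightarrow> 'a \<Rightarrow> bool" where
  "local_max_on T f x \<longleftrightarrow> (\<exists>U. openin T U \<and> x \<in> U \<and> (\<forall>y\<in>U. f y \<le> f x))"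

definition stable_equilibrium :: "nat \<Rightarrow> state \<Rightarrow> bool" where
  "stable_equilibrium K s \<longleftrightarrow>
     equilibrium K s \<and> local_max_on (state_topology K) (cut_V K) s"

definition definite_color :: "nat \<Rightarrow> state \<Rightarrow> bool" where
  "definite_color K s \<longleftrightarrow>
     (\<exists>\<alpha>\<in>{1..K}. sgm s \<alpha> = 1 \<and> (\<forall>\<beta>\<in>{1..K} - {\<alpha>}. sgm s \<beta> = -1))"

end

theory Submission
  imports Defs
begin

text \<open>
  Moving a single spin \<open>\<alpha>\<close> by a small \<open>\<delta> > 0\<close> changes the cut by \<open>\<delta>\<close> times its velocity plus
  \<open>\<delta>/2\<close> times the sum of \<open>q\<^sub>\<beta> \<sigma>\<^sub>\<alpha> \<sigma>\<^sub>\<beta>\<close> over the other nodes at the same position. At a stable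
  equilibrium the latter sum is therefore nonpositive, so a cluster of spins away from the auxiliary
  position \<open>0\<close> has total charge \<open>\<Sum> q\<^sub>\<beta> \<sigma>\<^sub>\<beta>\<close> in \<open>{-1, 0, 1}\<close>. If some spin is not at \<open>0\<close>, then the leftmost
  or the rightmost cluster is of this kind, and its vanishing velocity says that its charge equals
  the total charge \<open>T\<close> of all nodes. Since \<open>T\<close> is even, \<open>T = 0\<close>, that is, exactly one spin is
  positive. If all spins are at \<open>0\<close>, the same inequality applied to the whole complex excludes
  \<open>T \<ge> 2\<close> and \<open>T \<le> -2\<close>.
\<close>

definition cluster :: "nat \<Rightarrow> state \<Rightarrow> nat \<Rightarrow> nat set" where
  "cluster K s \<alpha> = {\<beta>\<in>{0..K}. pos s \<beta> = pos s \<alpha>}"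

text \<open>No wrap-around is built in: [-1, 1) is open on the right, so a small \<delta> > 0 leaves
  every \<sigma> unchanged. A negative shift from -1 would flip it, hence only positive ones are
  tested.\<close>

definition shift :: "state \<Rightarrow> nat \<Rightarrow> real \<Rightarrow> state" where
  "shift s \<alpha> \<delta> = s(\<alpha> := (fst (s \<alpha>), snd (s \<alpha>) + \<delta>))"

lemma sgm_shift [simp]: "sgm (shift s \<alpha> \<delta>) = sgm s"
  by (auto simp: sgm_def shift_def fun_eq_iff)

lemma pos_shift: "\<alpha> \<ge> 1 \<Longrightarrow> pos (shift s \<alpha> \<delta>) \<beta> = (if \<beta> = \<alpha> then pos s \<alpha> + \<delta> else pos s \<beta>)"
  by (auto simp: pos_def shift_def)

lemma state_cases:
  assumes "s \<in> topspace (state_topology K)" "\<alpha> \<in> {1..K}"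
  shows "sgm s \<alpha> = 1 \<or> sgm s \<alpha> = -1" "-1 \<le> pos s \<alpha>" "pos s \<alpha> < 1"
  using assms by (auto simp: topspace_state_topology PiE_iff relaxed_spins_def sgm_def pos_def mem_Times_iff)

text \<open>The preimage of \<open>V\<close> in the real line contains an interval around
  \<open>fst p + snd p\<close>. The second bound \<open>1 - snd p\<close> keeps the moved pair a
  relaxed spin, so uniqueness of representation identifies it with the spin found in
  \<open>V\<close>.\<close>

lemma circle_open_shift:
  assumes "openin circle_topology V" "p \<in> V"
  shows "\<exists>e>0. \<forall>\<delta>. 0 < \<delta> \<and> \<delta> < e \<longrightarrow> (fst p, snd p + \<delta>) \<in> V"
proof -
  let ?P = "{\<xi>. \<exists>p\<in>V. represents p \<xi>}"
  have V: "V \<subseteq> relaxed_spins" "open ?P" using assms(1) by (auto simp: openin_circle_topology)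
  have "represents p (fst p + snd p)" unfolding represents_def by (rule exI[of _ 0]) simp
  then have "fst p + snd p \<in> ?P" using assms(2) by blast
  then obtain e where e: "e > 0" "\<And>\<xi>. dist \<xi> (fst p + snd p) < e \<Longrightarrow> \<xi> \<in> ?P"
    using V(2) unfolding open_dist by blast
  have pr: "p \<in> relaxed_spins" using assms V by blast
  then have lt: "snd p < 1" by (auto simp: relaxed_spins_def)
  show ?thesis
  proof (intro exI[of _ "min e (1 - snd p)"] conjI allI impI)
    show "0 < min e (1 - snd p)" using e lt by simp
    fix \<delta> assume d: "0 < \<delta> \<and> \<delta> < min e (1 - snd p)"
    let ?q = "(fst p, snd p + \<delta>)"
    have "dist (fst p + snd p + \<delta>) (fst p + snd p) < e" using d by (simp add: dist_real_def)
    then obtain r where r: "r \<in> V" "represents r (fst p + snd p + \<delta>)" using e(2) by blast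
    have "represents ?q (fst p + snd p + \<delta>)" unfolding represents_def by (rule exI[of _ 0]) simp
    moreover have "?q \<in> relaxed_spins" using pr d by (auto simp: relaxed_spins_def)
    ultimately show "?q \<in> V" using r V(1) represents_unique by blast
  qed
qed

lemma state_open_shift:
  assumes "openin (state_topology K) U" "s \<in> U" "\<alpha> \<in> {1..K}"
  shows "\<exists>e>0. \<forall>\<delta>. 0 < \<delta> \<and> \<delta> < e \<longrightarrow> shift s \<alpha> \<delta> \<in> U"
proof -
  obtain V where V: "\<And>i. i \<in> {1..K} \<Longrightarrow> openin circle_topology (V i)"
      "s \<in> Pi\<^sub>E {1..K} V" "Pi\<^sub>E {1..K} V \<subseteq> U"
    using assms(1,2) unfolding state_topology_def openin_product_topology_alt by (metis (no_types, lifting))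
  have "s \<alpha> \<in> V \<alpha>" using V(2) assms(3) by (rule PiE_mem)
  then obtain e where e: "e > 0" "\<And>\<delta>. 0 < \<delta> \<Longrightarrow> \<delta> < e \<Longrightarrow> (fst (s \<alpha>), snd (s \<alpha>) + \<delta>) \<in> V \<alpha>"
    using circle_open_shift[OF V(1)[OF assms(3)]] by blast
  have "shift s \<alpha> \<delta> \<in> Pi\<^sub>E {1..K} V" if "0 < \<delta>" "\<delta> < e" for \<delta>
    using PiE_fun_upd[OF e(2)[OF that] V(2)] assms(3) by (simp add: shift_def insert_absorb)
  then show ?thesis using e(1) V(3) by blast
qed

text \<open>Only row and column \<open>a\<close> carry nonzero entries; symmetry makes their
  contributions equal, and the corner is zero.\<close>

lemma sum_sum_cross:
  fixes h :: "'a \<Rightarrow> 'a \<Rightarrow> real"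
  assumes "finite A" "a \<in> A" "\<And>x y. x \<noteq> a \<Longrightarrow> y \<noteq> a \<Longrightarrow> h x y = 0"
    and "\<And>x y. h x y = h y x" "h a a = 0"
  shows "(\<Sum>x\<in>A. \<Sum>y\<in>A. h x y) = 2 * (\<Sum>y\<in>A - {a}. h a y)"
proof -
  have row: "(\<Sum>y\<in>A. h x y) = h a x" if "x \<in> A - {a}" for x
  proof -
    have "(\<Sum>y\<in>A. h x y) = h x a + (\<Sum>y\<in>A - {a}. h x y)" using assms(1,2) by (rule sum.remove)
    moreover have "(\<Sum>y\<in>A - {a}. h x y) = 0" using that assms(3) by (intro sum.neutral) auto
    ultimately show ?thesis using assms(4)[of x a] by linarith
  qed
  have "(\<Sum>x\<in>A. \<Sum>y\<in>A. h x y) = (\<Sum>y\<in>A. h a y) + (\<Sum>x\<in>A - {a}. h a x)"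
    unfolding sum.remove[OF assms(1,2), of "\<lambda>x. \<Sum>y\<in>A. h x y"]
    by (intro arg_cong2[where f = "(+)"] sum.cong refl row)
  also have "(\<Sum>y\<in>A. h a y) = (\<Sum>y\<in>A - {a}. h a y)"
    by (simp add: sum.remove[OF assms(1,2), of "h a"] assms(5))
  finally show ?thesis by simp
qed

text \<open>The first sum in \<open>cut_V\<close> depends on signs only and cancels. In the second,
  only pairs containing \<alpha> change, each counted twice, which turns 1/4 into 1/2.\<close>

lemma cut_V_shift:
  assumes "\<alpha> \<in> {1..K}"
  shows "cut_V K (shift s \<alpha> \<delta>) - cut_V K s =
    (1/2) * (\<Sum>\<beta>\<in>{0..K} - {\<alpha>}. charge K \<beta> * sgm s \<alpha> * sgm s \<beta> *
        (\<bar>pos s \<alpha> + \<delta> - pos s \<beta>\<bar> - \<bar>pos s \<alpha> - pos s \<beta>\<bar>))"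
proof -
  let ?t = "shift s \<alpha> \<delta>"
  define h where "h \<beta> \<gamma> = weight K \<beta> \<gamma> * sgm s \<beta> * sgm s \<gamma> *
      (\<bar>pos ?t \<beta> - pos ?t \<gamma>\<bar> - \<bar>pos s \<beta> - pos s \<gamma>\<bar>)" for \<beta> \<gamma>
  have a: "\<alpha> \<ge> 1" using assms by simp
  have "cut_V K ?t - cut_V K s = (1/4) * (\<Sum>\<beta>=0..K. \<Sum>\<gamma>=0..K. h \<beta> \<gamma>)"
    by (simp add: cut_V_def h_def right_diff_distrib sum_subtractf)
  also have "(\<Sum>\<beta>=0..K. \<Sum>\<gamma>=0..K. h \<beta> \<gamma>) = 2 * (\<Sum>\<gamma>\<in>{0..K} - {\<alpha>}. h \<alpha> \<gamma>)"
    by (rule sum_sum_cross)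
      (use assms in \<open>auto simp: h_def pos_shift[OF a] weight_def abs_minus_commute\<close>)
  also have "(\<Sum>\<gamma>\<in>{0..K} - {\<alpha>}. h \<alpha> \<gamma>) = (\<Sum>\<beta>\<in>{0..K} - {\<alpha>}. charge K \<beta> * sgm s \<alpha> * sgm s \<beta> *
        (\<bar>pos s \<alpha> + \<delta> - pos s \<beta>\<bar> - \<bar>pos s \<alpha> - pos s \<beta>\<bar>))"
    by (rule sum.cong) (auto simp: h_def pos_shift[OF a] weight_eq_charge[OF a])
  finally show ?thesis by simp
qed

text \<open>Below the gap no spin is overtaken, so each distance is linear in \<delta> with slope
  the sign of the difference. Coincident nodes have slope 1 although \<open>sgn 0 = 0\<close>; they
  give the extra term that \<open>velocity\<close> does not see.\<close>

lemma cut_V_shift_small: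
  assumes a: "\<alpha> \<in> {1..K}" and d: "\<delta> > 0"
    and gap: "\<And>\<beta>. \<beta> \<in> {0..K} \<Longrightarrow> pos s \<beta> \<noteq> pos s \<alpha> \<Longrightarrow> \<delta> < \<bar>pos s \<alpha> - pos s \<beta>\<bar>"
  shows "cut_V K (shift s \<alpha> \<delta>) - cut_V K s =
    \<delta> * velocity K s \<alpha> + \<delta> / 2 * (sgm s \<alpha> * (\<Sum>\<beta>\<in>cluster K s \<alpha> - {\<alpha>}. charge K \<beta> * sgm s \<beta>))"
proof -
  let ?c = "\<lambda>\<beta>. charge K \<beta> * sgm s \<alpha> * sgm s \<beta>"
  let ?B = "{0..K} - {\<alpha>}"
  have split: "\<bar>pos s \<alpha> + \<delta> - pos s \<beta>\<bar> - \<bar>pos s \<alpha> - pos s \<beta>\<bar> =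
      \<delta> * sgn (pos s \<alpha> - pos s \<beta>) + \<delta> * of_bool (pos s \<beta> = pos s \<alpha>)" if "\<beta> \<in> ?B" for \<beta>
    using gap[of \<beta>] that d by (auto simp: sgn_if)
  have "2 * (cut_V K (shift s \<alpha> \<delta>) - cut_V K s) = (\<Sum>\<beta>\<in>?B. ?c \<beta> *
      (\<delta> * sgn (pos s \<alpha> - pos s \<beta>) + \<delta> * of_bool (pos s \<beta> = pos s \<alpha>)))"
    unfolding cut_V_shift[OF a] by (simp, intro sum.cong refl arg_cong2[where f = "(*)"] split)
  also have "\<dots> = \<delta> * (\<Sum>\<beta>\<in>?B. ?c \<beta> * sgn (pos s \<alpha> - pos s \<beta>))
      + \<delta> * (\<Sum>\<beta>\<in>?B. ?c \<beta> * of_bool (pos s \<beta> = pos s \<alpha>))"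
    by (simp add: sum_distrib_left sum.distrib algebra_simps)
  also have "(\<Sum>\<beta>\<in>?B. ?c \<beta> * sgn (pos s \<alpha> - pos s \<beta>)) = 2 * velocity K s \<alpha>"
    unfolding velocity_def using a by (simp add: sum.remove[of "{0..K}" \<alpha>])
  also have "(\<Sum>\<beta>\<in>?B. ?c \<beta> * of_bool (pos s \<beta> = pos s \<alpha>)) = (\<Sum>\<beta>\<in>cluster K s \<alpha> - {\<alpha>}. ?c \<beta>)"
    by (rule sum.mono_neutral_cong_right) (auto simp: cluster_def)
  also have "\<dots> = sgm s \<alpha> * (\<Sum>\<beta>\<in>cluster K s \<alpha> - {\<alpha>}. charge K \<beta> * sgm s \<beta>)"
    by (simp add: sum_distrib_left mult_ac)
  finally show ?thesis by (simp add: field_simps)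
qed

lemma stable_cluster_rest:
  assumes "stable_equilibrium K s" "\<alpha> \<in> {1..K}"
  shows "sgm s \<alpha> * (\<Sum>\<beta>\<in>cluster K s \<alpha> - {\<alpha>}. charge K \<beta> * sgm s \<beta>) \<le> 0" (is "?S \<le> 0")
proof -
  obtain U where U: "openin (state_topology K) U" "s \<in> U" "\<And>y. y \<in> U \<Longrightarrow> cut_V K y \<le> cut_V K s"
    using assms(1) unfolding stable_equilibrium_def local_max_on_def by blast
  obtain e where e: "e > 0" "\<And>\<delta>. 0 < \<delta> \<Longrightarrow> \<delta> < e \<Longrightarrow> shift s \<alpha> \<delta> \<in> U"
    using state_open_shift[OF U(1,2) assms(2)] by blast
  \<comment> \<open>A \<delta> below \<open>Min G\<close> stays in the neighbourhood and below every
    gap; \<open>e\<close> also makes \<open>G\<close> nonempty.\<close>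
  define G where "G = insert e ((\<lambda>\<beta>. \<bar>pos s \<alpha> - pos s \<beta>\<bar>) ` {\<beta>\<in>{0..K}. pos s \<beta> \<noteq> pos s \<alpha>})"
  have fin: "finite G" by (simp add: G_def)
  have "Min G > 0" using fin e(1) by (subst Min_gr_iff) (auto simp: G_def)
  then obtain \<delta> where \<delta>: "0 < \<delta>" "\<delta> < Min G" using dense by blast
  have less: "\<delta> < x" if "x \<in> G" for x using \<delta>(2) Min_le[OF fin that] by simp
  have "cut_V K (shift s \<alpha> \<delta>) \<le> cut_V K s" by (intro U(3) e(2) \<delta>(1) less) (simp add: G_def)
  moreover have "cut_V K (shift s \<alpha> \<delta>) - cut_V K s = \<delta> * velocity K s \<alpha> + \<delta> / 2 * ?S"
    by (rule cut_V_shift_small[OF assms(2) \<delta>(1)]) (auto intro!: less simp: G_def)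
  moreover have "velocity K s \<alpha> = 0"
    using assms unfolding stable_equilibrium_def equilibrium_def by blast
  ultimately have "\<delta> / 2 * ?S \<le> 0" by simp
  then show ?thesis using \<delta>(1) by (simp add: mult_le_0_iff)
qed

text \<open>Putting \<alpha> back into the sum adds its own term, the square of a sign.\<close>

lemma stable_cluster_charge:
  assumes "stable_equilibrium K s" "\<alpha> \<in> {1..K}"
  shows "sgm s \<alpha> * (\<Sum>\<beta>\<in>cluster K s \<alpha>. charge K \<beta> * sgm s \<beta>) \<le> 1"
proof -
  have "sgm s \<alpha> * sgm s \<alpha> = 1"
    using assms state_cases(1)[of s K \<alpha>] by (auto simp: stable_equilibrium_def equilibrium_def)
  moreover have "charge K \<alpha> = 1" using assms(2) by (simp add: charge_def)
  moreover have "(\<Sum>\<beta>\<in>cluster K s \<alpha>. charge K \<beta> * sgm s \<beta>) =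
      charge K \<alpha> * sgm s \<alpha> + (\<Sum>\<beta>\<in>cluster K s \<alpha> - {\<alpha>}. charge K \<beta> * sgm s \<beta>)"
    using assms(2) by (intro sum.remove) (auto simp: cluster_def)
  ultimately show ?thesis using stable_cluster_rest[OF assms] by (simp add: distrib_left)
qed

lemma cluster_charge_bound:
  assumes "stable_equilibrium K s" "\<alpha> \<in> {1..K}" "pos s \<alpha> \<noteq> 0"
  shows "\<bar>\<Sum>\<beta>\<in>cluster K s \<alpha>. charge K \<beta> * sgm s \<beta>\<bar> \<le> 1" (is "\<bar>?t\<bar> \<le> 1")
proof (rule ccontr)
  assume big: "\<not> \<bar>?t\<bar> \<le> 1"
  have st: "s \<in> topspace (state_topology K)"
    using assms(1) by (simp add: stable_equilibrium_def equilibrium_def)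
  have nz: "\<beta> \<in> {1..K}" if "\<beta> \<in> cluster K s \<alpha>" for \<beta>
    using that assms(3) by (cases "\<beta> = 0") (auto simp: cluster_def pos_def)
  have le1: "sgm s \<beta> * ?t \<le> 1" if "\<beta> \<in> cluster K s \<alpha>" for \<beta>
  proof -
    have "cluster K s \<beta> = cluster K s \<alpha>" using that by (auto simp: cluster_def)
    then show ?thesis using stable_cluster_charge[OF assms(1) nz[OF that]] by simp
  qed
  \<comment> \<open>This product is plus or minus \<open>?t\<close>, of modulus above 1; being at
    most 1, it is negative.\<close>
  have "sgm s \<beta> * ?t \<le> 0" if "\<beta> \<in> cluster K s \<alpha>" for \<beta>
    using le1[OF that] state_cases(1)[OF st nz[OF that]] big by auto
  then have "(\<Sum>\<beta>\<in>cluster K s \<alpha>. sgm s \<beta> * ?t) \<le> 0" by (rule sum_nonpos)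
  \<comment> \<open>The auxiliary node sits at 0, outside this cluster, so all charges here are 1
    and the summed inequality bounds the square of \<open>?t\<close>.\<close>
  moreover have "?t = (\<Sum>\<beta>\<in>cluster K s \<alpha>. sgm s \<beta>)"
    by (rule sum.cong) (use nz in \<open>auto simp: charge_def\<close>)
  ultimately have "?t * ?t \<le> 0" by (simp add: sum_distrib_right)
  then have "?t = 0" using zero_le_square[of ?t] by (metis antisym mult_eq_0_iff)
  then show False using big by simp
qed

text \<open>All nodes outside an extremal cluster lie on the same side, so their signs factor out of
  the vanishing velocity and their charges sum to 0.\<close>

lemma total_eq_extremal_cluster:
  assumes "equilibrium K s" "\<alpha> \<in> {1..K}" and c: "c \<noteq> 0"
    and ext: "\<And>\<beta>. \<beta> \<in> {0..K} \<Longrightarrow> pos s \<beta> \<noteq> pos s \<alpha> \<Longrightarrow> sgn (pos s \<alpha> - pos s \<beta>) = c"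
  shows "(\<Sum>\<beta>=0..K. charge K \<beta> * sgm s \<beta>) = (\<Sum>\<beta>\<in>cluster K s \<alpha>. charge K \<beta> * sgm s \<beta>)"
proof -
  have "sgm s \<alpha> \<noteq> 0"
    using assms(1,2) state_cases(1)[of s K \<alpha>] by (auto simp: equilibrium_def)
  have "velocity K s \<alpha> = 0" using assms(1,2) by (simp add: equilibrium_def)
  then have "0 = (\<Sum>\<beta>=0..K. charge K \<beta> * sgm s \<alpha> * sgm s \<beta> * sgn (pos s \<alpha> - pos s \<beta>))"
    by (simp add: velocity_def)
  also have "\<dots> = (\<Sum>\<beta>\<in>{0..K} - cluster K s \<alpha>. c * sgm s \<alpha> * (charge K \<beta> * sgm s \<beta>))"
    by (rule sum.mono_neutral_cong_right) (auto simp: cluster_def ext)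
  also have "\<dots> = c * sgm s \<alpha> * (\<Sum>\<beta>\<in>{0..K} - cluster K s \<alpha>. charge K \<beta> * sgm s \<beta>)"
    by (simp add: sum_distrib_left)
  finally have "(\<Sum>\<beta>\<in>{0..K} - cluster K s \<alpha>. charge K \<beta> * sgm s \<beta>) = 0"
    using c \<open>sgm s \<alpha> \<noteq> 0\<close> by simp
  then show ?thesis
    by (subst sum.subset_diff[of "cluster K s \<alpha>"]) (auto simp: cluster_def)
qed

lemma total_charge_bound:
  assumes "stable_equilibrium K s" "\<alpha> \<in> {1..K}" "pos s \<alpha> \<noteq> 0"
  shows "\<bar>\<Sum>\<beta>=0..K. charge K \<beta> * sgm s \<beta>\<bar> \<le> 1"
proof -
  have eq: "equilibrium K s" using assms(1) by (simp add: stable_equilibrium_def)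
  have p0: "pos s 0 = 0" by (simp add: pos_def)
  define m where "m = Min (pos s ` {0..K})"
  define M where "M = Max (pos s ` {0..K})"
  have m: "m \<le> pos s \<beta>" and M: "pos s \<beta> \<le> M" if "\<beta> \<in> {0..K}" for \<beta>
    using that by (auto simp: m_def M_def)
  have "m \<in> pos s ` {0..K}" "M \<in> pos s ` {0..K}" unfolding m_def M_def by (auto intro!: Min_in Max_in)
  then obtain a b where ab: "a \<in> {0..K}" "pos s a = m" "b \<in> {0..K}" "pos s b = M" by (metis imageE)
  \<comment> \<open>A spin off 0 puts one extreme strictly beyond the auxiliary node, so the cluster
    there does not contain that node.\<close>
  have "m < 0 \<or> M > 0" using m[of \<alpha>] M[of \<alpha>] assms(2,3) by auto
  then show ?thesis
  proof
    assume "m < 0"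
    then have a: "a \<in> {1..K}" "pos s a \<noteq> 0" using ab p0 by (auto simp: Suc_le_eq intro: ccontr)
    have "sgn (pos s a - pos s \<beta>) = -1" if "\<beta> \<in> {0..K}" "pos s \<beta> \<noteq> pos s a" for \<beta>
      using m[OF that(1)] that(2) ab by (simp add: sgn_if)
    then show ?thesis
      using total_eq_extremal_cluster[OF eq a(1), of "-1"] cluster_charge_bound[OF assms(1) a] by simp
  next
    assume "M > 0"
    then have b: "b \<in> {1..K}" "pos s b \<noteq> 0" using ab p0 by (auto simp: Suc_le_eq intro: ccontr)
    have "sgn (pos s b - pos s \<beta>) = 1" if "\<beta> \<in> {0..K}" "pos s \<beta> \<noteq> pos s b" for \<beta>
      using M[OF that(1)] that(2) ab by (simp add: sgn_if)
    then show ?thesis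
      using total_eq_extremal_cluster[OF eq b(1), of 1] cluster_charge_bound[OF assms(1) b] by simp
  qed
qed

text \<open>With p positive spins the signs sum to 2p - K; the auxiliary charge K - 2 cancels the
  dependence on K.\<close>

lemma total_charge_eq:
  assumes "s \<in> topspace (state_topology K)"
  shows "(\<Sum>\<beta>=0..K. charge K \<beta> * sgm s \<beta>) = 2 * real (card {\<beta>\<in>{1..K}. sgm s \<beta> = 1}) - 2"
proof -
  have "(\<Sum>\<beta>=0..K. charge K \<beta> * sgm s \<beta>) = (real K - 2) + (\<Sum>\<beta>=1..K. sgm s \<beta>)"
    by (simp add: sum.atLeast_Suc_atMost charge_def sgm_def)
  also have "(\<Sum>\<beta>=1..K. sgm s \<beta>) = (\<Sum>\<beta>=1..K. 2 * of_bool (sgm s \<beta> = 1) - 1)"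
    by (rule sum.cong) (use state_cases(1)[OF assms] in auto)
  also have "\<dots> = 2 * real (card {\<beta>\<in>{1..K}. sgm s \<beta> = 1}) - real K"
    by (simp add: sum_subtractf flip: sum_distrib_left) (simp add: Int_def)
  finally show ?thesis by simp
qed

theorem theorem1:
  fixes K :: nat and s :: state
  assumes "K \<ge> 1"
    and "stable_equilibrium K s"
  shows "definite_color K s"
proof -
  define P where "P = {\<beta>\<in>{1..K}. sgm s \<beta> = 1}"
  let ?T = "\<Sum>\<beta>=0..K. charge K \<beta> * sgm s \<beta>"
  have st: "s \<in> topspace (state_topology K)"
    using assms(2) by (simp add: stable_equilibrium_def equilibrium_def)
  have T: "?T = 2 * real (card P) - 2" unfolding P_def by (rule total_charge_eq[OF st])
  have "card P = 1"
  proof (cases "\<exists>\<alpha>\<in>{1..K}. pos s \<alpha> \<noteq> 0")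
    case True
    then have "\<bar>?T\<bar> \<le> 1" using total_charge_bound[OF assms(2)] by blast
    then show ?thesis unfolding T by linarith
  next
    case False
    then have "pos s \<beta> = 0" if "\<beta> \<in> {0..K}" for \<beta>
      using that by (cases "\<beta> = 0") (auto simp: pos_def)
    then have "cluster K s \<alpha> = {0..K}" if "\<alpha> \<in> {1..K}" for \<alpha>
      using that by (auto simp: cluster_def)
    then have le1: "sgm s \<alpha> * ?T \<le> 1" if "\<alpha> \<in> {1..K}" for \<alpha>
      using stable_cluster_charge[OF assms(2) that] that by simp
    show ?thesis
    proof (cases "P = {}")
      case True
      then have "sgm s 1 = -1" using state_cases(1)[OF st, of 1] assms(1) by (auto simp: P_def)
      \<comment> \<open>Here \<open>?T\<close> is -2 and node 1 is negative, so \<open>le1\<close>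
        would give 2 \<le> 1.\<close>
      then show ?thesis using le1[of 1] assms(1) True by (simp add: T)
    next
      case False
      then obtain \<alpha> where "\<alpha> \<in> P" by blast
      then have "?T \<le> 1" using le1[of \<alpha>] by (simp add: P_def)
      moreover have "card P \<noteq> 0" using False by (simp add: P_def)
      \<comment> \<open>Integrality enters: 2 p - 2 \<le> 1 with p nonzero leaves p = 1.\<close>
      ultimately show ?thesis unfolding T by linarith
    qed
  qed
  then obtain \<alpha> where "P = {\<alpha>}" by (auto simp: card_1_singleton_iff)
  then have "sgm s \<beta> = 1 \<longleftrightarrow> \<beta> = \<alpha>" if "\<beta> \<in> {1..K}" for \<beta>
    using that unfolding P_def by blast
  moreover have "\<alpha> \<in> {1..K}" using \<open>P = {\<alpha>}\<close> by (auto simp: P_def)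
  ultimately show ?thesis
    unfolding definite_color_def using state_cases(1)[OF st] by blast
qed

end
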